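(* Let $G$ be a Helly graph and $k$ a non-negative integer. (i) $hb(G)\le k$ if and only if $G$ contains no $H_2^{k}$ as an isometric subgraph. (ii) $hb(G)\le k+\frac12$ if and only if $G$ contains neither $H_1^{k+1}$ nor $H_3^{k}$ as an isometric subgraph.
   Context: Graphs are finite, connected, unweighted, undirected and simple; $d$ is the shortest-path distance. A subgraph is isometric if it is induced and distance-preserving; "contains $H$ as an isometric subgraph" means has an isometric subgraph isomorphic to $H$. A graph is Helly if every family of pairwise intersecting disks $D(v,r)=\{u:d(u,v)\le r\}$ has a common vertex. $hb(G)$ is the maximum over quadruples $u,v,w,x$ of one half of the difference between the two largest of $d(u,v)+d(w,x)$, $d(u,w)+d(v,x)$, $d(u,x)+d(v,w)$. King-grid: the graph on $\mathbb{Z}^2$ in which distinct $(x,y),(x',y')$ are adjacent iff $\max(|x-x'|,|y-y'|)=1$; for $u=(x,y)$ let $s(u)=x+y$, $t(u)=x-y$. For an integer $m\ge0$: - $H_1^{m}$ is induced by $\{u: 0\le s(u)\le 2m,\ 0\le t(u)\le 2m\}$; - $H_2^{m}$ is induced by $\{u: 0\le s(u)\le 2m+1,\ -1\le t(u)\le 2m\}\cup\{(-1,0),(2m+1,1)\}$; - $H_3^{m}$ is induced by $\{u: 0\le s(u)\le 2m+2,\ -1\le t(u)\le 2m+1\}\cup\{(m,-m-1),(-1,1),(m+1,m+2),(2m+2,0)\}$. *)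

theory Defs
  imports Graph_Theory.Graph_Theory
begin

text \<open>
  The length of a shortest walk. The value is unspecified if there is no walk from \<open>u\<close> to \<open>v\<close>;
  it is only used on connected graphs.
\<close>
definition gdist :: "('a, 'b) pre_digraph \<Rightarrow> 'a \<Rightarrow> 'a \<Rightarrow> nat" where
  "gdist G u v = (LEAST n. \<exists>p. pre_digraph.awalk G u p v \<and> length p = n)"

lemma (in wf_digraph) gdist_eq_shortest_path:
  assumes "u \<rightarrow>\<^sup>* v"
  shows "\<mu> (\<lambda>_. 1) u v = ereal (real (gdist G u v))"
proof -
  have cost: "awalk_cost (\<lambda>_. 1) p = real (length p)" for p
    by (induction p) auto
  from assms have "\<exists>n p. awalk u p v \<and> length p = n"
    by (simp add: reachable_awalk)
  from LeastI_ex[OF this] obtain p where p: "awalk u p v" "length p = gdist G u v"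
    unfolding gdist_def by blast
  have least: "gdist G u v \<le> length q" if "awalk u q v" for q
    unfolding gdist_def using that by (intro Least_le) auto
  show ?thesis
  proof (rule antisym)
    show "\<mu> (\<lambda>_. 1) u v \<le> ereal (real (gdist G u v))"
      using min_cost_le_walk_cost[OF p(1), of "\<lambda>_. 1"] p(2) by (simp add: cost)
    show "ereal (real (gdist G u v)) \<le> \<mu> (\<lambda>_. 1) u v"
      unfolding \<mu>_def by (rule INF_greatest) (use least in \<open>auto simp: cost\<close>)
  qed
qed

text \<open>
  Requiring \<open>connected H\<close> is in keeping with all graphs being connected; it ensures that
  \<open>gdist\<close> is meaningful on \<open>H\<close>.
\<close>
definition isometric_subgraph :: "('a, 'b) pre_digraph \<Rightarrow> ('a, 'b) pre_digraph \<Rightarrow> bool" where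
  "isometric_subgraph H G \<longleftrightarrow> induced_subgraph H G \<and> connected H \<and>
     (\<forall>u\<in>verts H. \<forall>v\<in>verts H. gdist H u v = gdist G u v)"

definition contains_isometric :: "('a, 'b) pre_digraph \<Rightarrow> ('c, 'd) pre_digraph \<Rightarrow> bool" where
  "contains_isometric G H \<longleftrightarrow> (\<exists>K. isometric_subgraph K G \<and> digraph_iso K H)"

definition disk :: "('a, 'b) pre_digraph \<Rightarrow> 'a \<Rightarrow> nat \<Rightarrow> 'a set" where
  "disk G v r = {u \<in> verts G. gdist G u v \<le> r}"

definition helly :: "('a, 'b) pre_digraph \<Rightarrow> bool" where
  "helly G \<longleftrightarrow>
     (\<forall>\<F>. \<F> \<subseteq> {disk G v r | v r. v \<in> verts G} \<longrightarrow>
          (\<forall>A\<in>\<F>. \<forall>B\<in>\<F>. A \<inter> B \<noteq> {}) \<longrightarrow>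
          (\<exists>u\<in>verts G. \<forall>A\<in>\<F>. u \<in> A))"

definition quad_hb :: "('a, 'b) pre_digraph \<Rightarrow> 'a \<Rightarrow> 'a \<Rightarrow> 'a \<Rightarrow> 'a \<Rightarrow> real" where
  "quad_hb G u v w x =
     (let s = sort [gdist G u v + gdist G w x,
                    gdist G u w + gdist G v x,
                    gdist G u x + gdist G v w]
      in (real (s ! 2) - real (s ! 1)) / 2)"

definition hb :: "('a, 'b) pre_digraph \<Rightarrow> real" where
  "hb G = Max {quad_hb G u v w x | u v w x.
     u \<in> verts G \<and> v \<in> verts G \<and> w \<in> verts G \<and> x \<in> verts G}"

definition king_grid :: "(int \<times> int, (int \<times> int) \<times> (int \<times> int)) pre_digraph" where
  "king_grid = \<lparr> verts = UNIV,
     arcs = {((x, y), (x', y')). max \<bar>x - x'\<bar> \<bar>y - y'\<bar> = 1},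
     tail = fst, head = snd \<rparr>"

definition H1 :: "nat \<Rightarrow> (int \<times> int, (int \<times> int) \<times> (int \<times> int)) pre_digraph" where
  "H1 m = king_grid \<restriction>
     {(x, y). 0 \<le> x + y \<and> x + y \<le> 2 * int m \<and> 0 \<le> x - y \<and> x - y \<le> 2 * int m}"

definition H2 :: "nat \<Rightarrow> (int \<times> int, (int \<times> int) \<times> (int \<times> int)) pre_digraph" where
  "H2 m = king_grid \<restriction>
     ({(x, y). 0 \<le> x + y \<and> x + y \<le> 2 * int m + 1 \<and> -1 \<le> x - y \<and> x - y \<le> 2 * int m}
      \<union> {(-1, 0), (2 * int m + 1, 1)})"

definition H3 :: "nat \<Rightarrow> (int \<times> int, (int \<times> int) \<times> (int \<times> int)) pre_digraph" where
  "H3 m = king_grid \<restriction>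
     ({(x, y). 0 \<le> x + y \<and> x + y \<le> 2 * int m + 2 \<and> -1 \<le> x - y \<and> x - y \<le> 2 * int m + 1}
      \<union> {(int m, - int m - 1), (-1, 1), (int m + 1, int m + 2), (2 * int m + 2, 0)})"

end

(*
  In the coordinates s = x + y, t = x - y the king-grid is a parity class of the integer plane
  with half the l1 metric.  Any four vertices a, b, c, d for which d(a,c) + d(b,d) is the largest
  of the three distance sums embed isometrically into this plane as a pinwheel: a rectangle
  [0,W] x [0,T] with a whisker at each corner, where W and T are the differences between the
  largest sum and the two others.  So hb(G) > (N - 1)/2 iff there are such vertices with
  W, T >= N.  As G is Helly, the map sending the four points of the plane to the four vertices
  extends to a nonexpansive map on every finite set of lattice points of the right parity, and it
  is exact on any two points that lie in this order on a geodesic joining two of the four points.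
  It remains to place H1, H2 or H3 in the pinwheel so that any two of its vertices are so related;
  which of them fits depends on the parity of the lattice and on whether W or T exceeds N.
  Conversely the four extreme points of each grid piece are themselves such a quadruple.
*)
theory Submission
  imports Defs
begin

section \<open>Shortest-path distances\<close>

context wf_digraph
begin

lemma gdist_le_length: "awalk u p v \<Longrightarrow> gdist G u v \<le> length p"
  unfolding gdist_def by (rule Least_le) blast

lemma shortest_awalkE:
  assumes "u \<rightarrow>\<^sup>* v"
  obtains p where "awalk u p v" "length p = gdist G u v"
proof -
  from assms have "\<exists>n p. awalk u p v \<and> length p = n"
    by (simp add: reachable_awalk)
  from LeastI_ex[OF this] show ?thesis
    using that unfolding gdist_def by blast
qed

lemma gdist_refl: "u \<in> verts G \<Longrightarrow> gdist G u u = 0"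
  using gdist_le_length[of u "[]" u] by (simp add: awalk_Nil_iff)

lemma gdist_triangle:
  assumes "u \<rightarrow>\<^sup>* v" "v \<rightarrow>\<^sup>* w"
  shows "gdist G u w \<le> gdist G u v + gdist G v w"
proof -
  obtain p where p: "awalk u p v" "length p = gdist G u v"
    using assms(1) by (rule shortest_awalkE)
  obtain q where q: "awalk v q w" "length q = gdist G v w"
    using assms(2) by (rule shortest_awalkE)
  show ?thesis
    using gdist_le_length[OF awalk_appendI[OF p(1) q(1)]] p(2) q(2) by simp
qed

lemma gdist_eq_0D: "u \<rightarrow>\<^sup>* v \<Longrightarrow> gdist G u v = 0 \<Longrightarrow> u = v"
  by (metis awalk_empty_ends length_0_conv shortest_awalkE)

lemma gdist_adj_le:
  assumes "u \<rightarrow> v"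
  shows "gdist G u v \<le> 1"
proof -
  from assms obtain e where e: "e \<in> arcs G" "tail G e = u" "head G e = v" by blast
  show ?thesis using gdist_le_length[OF arc_implies_awalk[OF e(1)]] e by simp
qed

lemma gdist_eq_1D:
  assumes "u \<rightarrow>\<^sup>* v" "gdist G u v = 1"
  shows "u \<rightarrow> v"
proof -
  obtain p where p: "awalk u p v" "length p = 1"
    using assms by (metis shortest_awalkE)
  then obtain e where "p = [e]" by (auto simp: length_Suc_conv)
  with p show ?thesis by (auto simp: awalk_simps intro: in_arcs_imp_in_arcs_ends)
qed

lemma gdist_splitE:
  assumes "u \<rightarrow>\<^sup>* v" "gdist G u v \<le> i + j"
  obtains w where "w \<in> verts G" "u \<rightarrow>\<^sup>* w" "w \<rightarrow>\<^sup>* v" "gdist G u w \<le> i" "gdist G w v \<le> j"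
proof -
  obtain p where p: "awalk u p v" "length p = gdist G u v"
    using assms(1) by (rule shortest_awalkE)
  \<comment> \<open>If the walk has fewer than \<open>i\<close> arcs, \<open>take i p\<close> is all
    of \<open>p\<close> and \<open>w\<close> is its end \<open>v\<close>.\<close>
  define w where "w = awlast u (take i p)"
  have "awalk u (take i p @ drop i p) v" using p by simp
  then have w: "awalk u (take i p) w" "awalk w (drop i p) v"
    unfolding w_def awalk_append_iff by auto
  show ?thesis
  proof
    show "w \<in> verts G" using w(2) by (rule awalk_hd_in_verts)
    show "u \<rightarrow>\<^sup>* w" "w \<rightarrow>\<^sup>* v" using w by (auto intro: reachable_awalkI)
    show "gdist G u w \<le> i" using gdist_le_length[OF w(1)] by simp
    show "gdist G w v \<le> j" using gdist_le_length[OF w(2)] p assms(2) by simp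
  qed
qed

lemma gdist_app_iso:
  assumes hom: "digraph_isomorphism hom" and uv: "u \<in> verts G" "v \<in> verts G"
  shows "gdist (app_iso hom G) (iso_verts hom u) (iso_verts hom v) = gdist G u v"
proof -
  have "(\<exists>p. pre_digraph.awalk (app_iso hom G) (iso_verts hom u) p (iso_verts hom v) \<and> length p = n)
    \<longleftrightarrow> (\<exists>p. awalk u p v \<and> length p = n)" (is "?L \<longleftrightarrow> ?R") for n
  proof
    assume ?L
    then obtain p where
      p: "pre_digraph.awalk (app_iso hom G) (iso_verts hom u) p (iso_verts hom v)" "length p = n"
      by blast
    from awalk_app_isoD[OF p(1) hom] p(2) show ?R
      using hom uv by (metis iso_verts_inv_iso length_map)
  next
    assume ?R
    then show ?L using awalk_app_isoI[OF _ hom] by (metis length_map)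
  qed
  then show ?thesis by (simp add: gdist_def)
qed

text \<open>
  The third hypothesis on \<open>d\<close> is Menger convexity; allowing the step to be taken at either end
  saves treating the two ends separately in the applications.
\<close>
lemma gdist_eqI:
  fixes d :: "'a \<Rightarrow> 'a \<Rightarrow> nat"
  assumes refl: "\<And>u v. u \<in> verts G \<Longrightarrow> v \<in> verts G \<Longrightarrow> d u v = 0 \<longleftrightarrow> u = v"
    and arc: "\<And>u v w. u \<rightarrow> v \<Longrightarrow> w \<in> verts G \<Longrightarrow> d u w \<le> Suc (d v w)"
    and step: "\<And>u v. u \<in> verts G \<Longrightarrow> v \<in> verts G \<Longrightarrow> u \<noteq> v \<Longrightarrow>
      \<exists>w\<in>verts G. u \<rightarrow> w \<and> d u v = Suc (d w v) \<or> w \<rightarrow> v \<and> d u v = Suc (d u w)"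
    and uv: "u \<in> verts G" "v \<in> verts G"
  shows "u \<rightarrow>\<^sup>* v" "gdist G u v = d u v"
proof -
  have upper: "u \<rightarrow>\<^sup>* v \<and> gdist G u v \<le> n" if "u \<in> verts G" "v \<in> verts G" "d u v = n" for u v n
    using that
  proof (induction n arbitrary: u v)
    case 0
    then show ?case using refl gdist_refl by auto
  next
    case (Suc n)
    then have "u \<noteq> v" using refl[of u v] by auto
    from step[OF Suc.prems(1,2) this] obtain w where w: "w \<in> verts G"
      "u \<rightarrow> w \<and> d w v = n \<or> w \<rightarrow> v \<and> d u w = n"
      using Suc.prems(3) by auto
    from w(2) show ?case
    proof (elim disjE conjE)
      assume "u \<rightarrow> w" "d w v = n"
      then show ?thesis
        using Suc.IH[of w v] w(1) Suc.prems gdist_triangle[of u w v] gdist_adj_le[of u w]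
        by (auto intro: adj_reachable_trans)
    next
      assume "w \<rightarrow> v" "d u w = n"
      then show ?thesis
        using Suc.IH[of u w] w(1) Suc.prems gdist_triangle[of u w v] gdist_adj_le[of w v]
        by (auto intro: reachable_adj_trans)
    qed
  qed
  \<comment> \<open>By \<open>arc\<close>, the value of \<open>d\<close> to a fixed target drops by
    at most one per arc, so no walk beats \<open>d\<close>; the walks built from \<open>step\<close>
    attain it.\<close>
  have lower: "d u v \<le> length p" if "awalk u p v" for u p
    using that
  proof (induction p arbitrary: u)
    case Nil
    then show ?case using refl by (auto simp: awalk_Nil_iff)
  next
    case (Cons e p)
    then have e: "tail G e \<rightarrow> head G e" "u = tail G e" "awalk (head G e) p v"
      by (auto simp: awalk_Cons_iff intro: in_arcs_imp_in_arcs_ends)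
    from arc[OF e(1) uv(2)] Cons.IH[OF e(3)] e(2) show ?case by simp
  qed
  show r: "u \<rightarrow>\<^sup>* v" using upper[OF uv] by blast
  show "gdist G u v = d u v"
  proof (rule antisym)
    show "gdist G u v \<le> d u v" using upper[OF uv] by blast
    show "d u v \<le> gdist G u v" using r by (metis lower shortest_awalkE)
  qed
qed

end

lemma (in sym_digraph) gdist_sym:
  assumes "u \<rightarrow>\<^sup>* v"
  shows "gdist G u v = gdist G v u"
proof -
  have step: "\<exists>q. awalk y q x \<and> length q = length p" if "awalk x p y" for x p y
    using that
  proof (induction p arbitrary: x)
    case Nil
    then show ?case by (auto simp: awalk_Nil_iff)
  next
    case (Cons e p)
    then obtain q where q: "awalk y q (head G e)" "length q = length p"
      by (auto simp: awalk_Cons_iff)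
    from Cons.prems obtain e' where "e' \<in> arcs G" "tail G e' = head G e" "head G e' = x"
      using sym_arcs by (fastforce simp: awalk_Cons_iff symmetric_conv)
    then have "awalk y (q @ [e']) x"
      using q(1) by (auto intro!: awalk_appendI simp: awalk_simps)
    then show ?case using q(2) by (metis length_Cons length_append_singleton)
  qed
  have le: "gdist G y x \<le> gdist G x y" if "x \<rightarrow>\<^sup>* y" for x y
    using that step by (metis gdist_le_length shortest_awalkE)
  show ?thesis using le[OF assms] le[OF symmetric_reachable'[OF assms]] by simp
qed

section \<open>Helly graphs and isometric pieces of the king-grid\<close>

locale connected_graph = graph +
  assumes connected: "connected G"
begin

lemma all_reachable: "u \<in> verts G \<Longrightarrow> v \<in> verts G \<Longrightarrow> u \<rightarrow>\<^sup>* v"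
  using symmetric_connected_imp_strongly_connected[OF sym_arcs connected]
  by (auto simp: strongly_connected_def)

lemma dist_sym: "u \<in> verts G \<Longrightarrow> v \<in> verts G \<Longrightarrow> gdist G u v = gdist G v u"
  by (rule gdist_sym[OF all_reachable])

lemma dist_triangle:
  "u \<in> verts G \<Longrightarrow> v \<in> verts G \<Longrightarrow> w \<in> verts G \<Longrightarrow> gdist G u w \<le> gdist G u v + gdist G v w"
  by (rule gdist_triangle[OF all_reachable all_reachable])

lemma dist_eq_0_iff: "u \<in> verts G \<Longrightarrow> v \<in> verts G \<Longrightarrow> gdist G u v = 0 \<longleftrightarrow> u = v"
  using gdist_eq_0D[OF all_reachable] gdist_refl by auto

lemma adj_iff_dist_eq_1:
  assumes "u \<in> verts G" "v \<in> verts G"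
  shows "u \<rightarrow> v \<longleftrightarrow> gdist G u v = 1"
proof
  assume "u \<rightarrow> v"
  then show "gdist G u v = 1"
    using gdist_adj_le[of u v] dist_eq_0_iff[OF assms] adj_not_same by (cases "gdist G u v") auto
qed (use gdist_eq_1D all_reachable assms in blast)

text \<open>Cut a shortest walk after \<open>i\<close> arcs. This makes the pairwise condition in
  \<open>helly\<close> a purely metric one.\<close>

lemma disks_meet:
  assumes "u \<in> verts G" "v \<in> verts G" "gdist G u v \<le> i + j"
  shows "disk G u i \<inter> disk G v j \<noteq> {}"
proof -
  obtain w where w: "w \<in> verts G" "gdist G u w \<le> i" "gdist G w v \<le> j"
    using gdist_splitE[OF all_reachable[OF assms(1,2)] assms(3)] by blast
  then show ?thesis using assms dist_sym by (auto simp: disk_def intro!: exI[of _ w])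
qed

text \<open>
  A Helly graph is a hyperconvex metric space, hence nonexpansive maps into it extend one point
  at a time.
\<close>
lemma helly_extension:
  fixes \<rho> :: "'p \<Rightarrow> 'p \<Rightarrow> nat"
  assumes helly: "helly G"
    and sym: "\<And>x y. \<rho> x y = \<rho> y x"
    and tri: "\<And>x y z. x \<in> X \<Longrightarrow> y \<in> X \<Longrightarrow> z \<in> X \<Longrightarrow> \<rho> x z \<le> \<rho> x y + \<rho> y z"
    and "finite X" "Y \<subseteq> X"
    and f: "\<And>y. y \<in> Y \<Longrightarrow> f y \<in> verts G"
      "\<And>y z. y \<in> Y \<Longrightarrow> z \<in> Y \<Longrightarrow> gdist G (f y) (f z) \<le> \<rho> y z"
  obtains g where "\<And>x. x \<in> X \<Longrightarrow> g x \<in> verts G"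
    "\<And>x y. x \<in> X \<Longrightarrow> y \<in> X \<Longrightarrow> gdist G (g x) (g y) \<le> \<rho> x y"
    "\<And>y. y \<in> Y \<Longrightarrow> g y = f y"
proof -
  let ?ext = "\<lambda>Z g. (\<forall>x\<in>Y \<union> Z. g x \<in> verts G) \<and> (\<forall>x\<in>Y \<union> Z. \<forall>y\<in>Y \<union> Z. gdist G (g x) (g y) \<le> \<rho> x y)
      \<and> (\<forall>y\<in>Y. g y = f y)"
  have "\<exists>g. ?ext Z g" if "finite Z" "Z \<subseteq> X - Y" for Z
    using that
  proof (induction Z)
    case empty
    show ?case using f by (intro exI[of _ f]) auto
  next
    case (insert z Z)
    then obtain g where "?ext Z g" by auto
    then have g: "\<And>x. x \<in> Y \<union> Z \<Longrightarrow> g x \<in> verts G"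
      "\<And>x y. x \<in> Y \<union> Z \<Longrightarrow> y \<in> Y \<union> Z \<Longrightarrow> gdist G (g x) (g y) \<le> \<rho> x y"
      "\<And>y. y \<in> Y \<Longrightarrow> g y = f y" by simp_all
    have sub: "x \<in> X" if "x \<in> Y \<union> Z" for x using that \<open>Y \<subseteq> X\<close> insert.prems by auto
    \<comment> \<open>A vertex common to these disks is an admissible image of \<open>z\<close>. The
      triangle inequality through \<open>z\<close> bounds the distance of two centres by the sum of
      the radii, so the disks meet pairwise.\<close>
    let ?F = "(\<lambda>x. disk G (g x) (\<rho> x z)) ` (Y \<union> Z)"
    have "gdist G (g x) (g y) \<le> \<rho> x z + \<rho> y z" if "x \<in> Y \<union> Z" "y \<in> Y \<union> Z" for x y
      using g(2)[OF that] tri[of x z y] sub that insert.prems sym[of y z] by fastforce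
    then have "\<forall>A\<in>?F. \<forall>B\<in>?F. A \<inter> B \<noteq> {}"
      using disks_meet g(1) by blast
    moreover have "?F \<subseteq> {disk G v r | v r. v \<in> verts G}" using g(1) by blast
    ultimately obtain w where w: "w \<in> verts G" "\<forall>A\<in>?F. w \<in> A"
      using helly unfolding helly_def by meson
    have w': "gdist G w (g x) \<le> \<rho> z x" "gdist G (g x) w \<le> \<rho> x z" if "x \<in> Y \<union> Z" for x
    proof -
      have "gdist G w (g x) \<le> \<rho> x z" using w(2) that by (auto simp: disk_def)
      then show "gdist G w (g x) \<le> \<rho> z x" "gdist G (g x) w \<le> \<rho> x z"
        using dist_sym[OF w(1) g(1)[OF that]] sym[of x z] by simp_all
    qed
    have z: "z \<notin> Y \<union> Z" using insert by auto
    show ?case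
    proof (intro exI[of _ "g(z := w)"] conjI ballI)
      fix x y assume xy: "x \<in> Y \<union> insert z Z" "y \<in> Y \<union> insert z Z"
      show "gdist G ((g(z := w)) x) ((g(z := w)) y) \<le> \<rho> x y"
        by (cases "x = z"; cases "y = z") (use xy g(2) w(1) w' gdist_refl in auto)
    qed (use g z w in auto)
  qed
  from this[of "X - Y"] have "\<exists>g. ?ext (X - Y) g" using \<open>finite X\<close> by simp
  then obtain g where "?ext (X - Y) g" ..
  moreover have "Y \<union> (X - Y) = X" using \<open>Y \<subseteq> X\<close> by blast
  ultimately show ?thesis by (intro that[of g]) simp_all
qed

end

section \<open>The king-grid metric and its convex pieces\<close>

definition cheb :: "int \<times> int \<Rightarrow> int \<times> int \<Rightarrow> nat" where
  "cheb u v = nat (max \<bar>fst u - fst v\<bar> \<bar>snd u - snd v\<bar>)"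

lemma two_cheb:
  "2 * int (cheb u v) = \<bar>(fst u + snd u) - (fst v + snd v)\<bar> + \<bar>(fst u - snd u) - (fst v - snd v)\<bar>"
proof -
  have "int (cheb u v) = max \<bar>fst u - fst v\<bar> \<bar>snd u - snd v\<bar>"
    by (simp add: cheb_def le_max_iff_disj)
  moreover have "2 * max \<bar>a\<bar> \<bar>b\<bar> = \<bar>a + b\<bar> + \<bar>a - b\<bar>" for a b :: int by linarith
  ultimately show ?thesis by (simp add: algebra_simps)
qed

lemma cheb_eq_0_iff: "cheb u v = 0 \<longleftrightarrow> u = v"
  by (auto simp: cheb_def prod_eq_iff)

lemma cheb_le_iff: "cheb u v \<le> n \<longleftrightarrow> \<bar>fst u - fst v\<bar> \<le> int n \<and> \<bar>snd u - snd v\<bar> \<le> int n"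
  by (simp add: cheb_def nat_le_iff)

lemma cheb_triangle: "cheb u w \<le> cheb u v + cheb v w"
proof -
  have "\<bar>fst p - fst q\<bar> \<le> int (cheb p q) \<and> \<bar>snd p - snd q\<bar> \<le> int (cheb p q)" for p q
    using cheb_le_iff by blast
  from this[of u v] this[of v w] show ?thesis unfolding cheb_le_iff by linarith
qed

text \<open>This is the \<open>step\<close> hypothesis of \<open>gdist_eqI\<close> for the Chebyshev
  metric: shortest paths of the plane can be chosen inside the set, one king move at a time.\<close>

definition menger_convex :: "(int \<times> int) set \<Rightarrow> bool" where
  "menger_convex S \<longleftrightarrow> (\<forall>u\<in>S. \<forall>v\<in>S. u \<noteq> v \<longrightarrow>
     (\<exists>w\<in>S. cheb u w = 1 \<and> cheb u v = Suc (cheb w v) \<or> cheb w v = 1 \<and> cheb u v = Suc (cheb u w)))"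

lemma wf_king_grid: "wf_digraph king_grid"
  by unfold_locales (auto simp: king_grid_def)

lemma arcs_ends_king_grid_restrict:
  "arcs_ends (king_grid \<restriction> S) = {(u, v). u \<in> S \<and> v \<in> S \<and> cheb u v = 1}"
  by (force simp: arcs_ends_conv king_grid_def cheb_def)

lemma gdist_king_grid_restrict:
  assumes "menger_convex S" "u \<in> S" "v \<in> S"
  shows "u \<rightarrow>\<^sup>*\<^bsub>king_grid \<restriction> S\<^esub> v" "gdist (king_grid \<restriction> S) u v = cheb u v"
proof -
  interpret wf_digraph "king_grid \<restriction> S"
    by (rule wf_digraph.wellformed_induce_subgraph[OF wf_king_grid])
  have arc: "cheb u w \<le> Suc (cheb v w)" if "cheb u v = 1" for u v w
    using cheb_triangle[of u w v] that by simp
  have step: "\<exists>w\<in>S. u \<rightarrow>\<^bsub>king_grid \<restriction> S\<^esub> w \<and> cheb u v = Suc (cheb w v)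
      \<or> w \<rightarrow>\<^bsub>king_grid \<restriction> S\<^esub> v \<and> cheb u v = Suc (cheb u w)"
    if uv: "u \<in> S" "v \<in> S" "u \<noteq> v" for u v
  proof -
    obtain w where "w \<in> S"
      "cheb u w = 1 \<and> cheb u v = Suc (cheb w v) \<or> cheb w v = 1 \<and> cheb u v = Suc (cheb u w)"
      using assms(1) uv unfolding menger_convex_def by blast
    then show ?thesis using uv by (auto simp: arcs_ends_king_grid_restrict)
  qed
  have arc': "cheb u w \<le> Suc (cheb v w)" if "u \<rightarrow>\<^bsub>king_grid \<restriction> S\<^esub> v" for u v w
    using that arc by (simp add: arcs_ends_king_grid_restrict)
  show "u \<rightarrow>\<^sup>*\<^bsub>king_grid \<restriction> S\<^esub> v"
    by (rule gdist_eqI(1)[of cheb]) (simp_all add: cheb_eq_0_iff arc' step assms)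
  show "gdist (king_grid \<restriction> S) u v = cheb u v"
    by (rule gdist_eqI(2)[of cheb]) (simp_all add: cheb_eq_0_iff arc' step assms)
qed

text \<open>A metric stand-in for containing an isometric copy, which frees the later constructions
  from arcs and isomorphism records.\<close>

definition (in pre_digraph) embeds :: "(int \<times> int) set \<Rightarrow> bool" where
  "embeds S \<longleftrightarrow> (\<exists>f. f ` S \<subseteq> verts G \<and> (\<forall>u\<in>S. \<forall>v\<in>S. gdist G (f u) (f v) = cheb u v))"

text \<open>Equality is distance zero and adjacency is distance one, so a distance-preserving map is
  injective and carries the whole graph structure. Convexity makes \<open>cheb\<close> the intrinsic
  distance of the piece as well, so copy and host can be compared.\<close>

lemma (in connected_graph) contains_isometric_king_grid_iff:
  assumes S: "menger_convex S" "S \<noteq> {}"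
  shows "contains_isometric G (king_grid \<restriction> S) \<longleftrightarrow> embeds S"
proof
  assume "contains_isometric G (king_grid \<restriction> S)"
  then obtain K hom where K: "isometric_subgraph K G"
    and hom: "pre_digraph.digraph_isomorphism K hom" "king_grid \<restriction> S = app_iso hom K"
    unfolding contains_isometric_def digraph_iso_def by blast
  interpret K: wf_digraph K using hom(1) unfolding pre_digraph.digraph_isomorphism_def by blast
  have S_eq: "S = iso_verts hom ` verts K" using hom(2) by (metis induce_subgraph_verts verts_app_iso)
  let ?f = "iso_verts (K.inv_iso hom)"
  have "?f ` S \<subseteq> verts K" using hom(1) by (simp add: S_eq)
  moreover have "verts K \<subseteq> verts G"
    using K by (auto simp: isometric_subgraph_def induced_subgraph_def)
  moreover have "gdist G (?f u) (?f v) = cheb u v" if "u \<in> S" "v \<in> S" for u v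
  proof -
    from that obtain x y where xy: "x \<in> verts K" "y \<in> verts K" "u = iso_verts hom x" "v = iso_verts hom y"
      by (auto simp: S_eq)
    have "gdist G x y = gdist K x y" using K xy by (simp add: isometric_subgraph_def)
    also have "\<dots> = gdist (king_grid \<restriction> S) u v"
      using K.gdist_app_iso[OF hom(1) xy(1,2)] xy hom(2) by simp
    also have "\<dots> = cheb u v" using gdist_king_grid_restrict S that by blast
    finally show ?thesis using xy hom(1) by simp
  qed
  ultimately show "embeds S"
    unfolding embeds_def by blast
next
  assume "embeds S"
  then obtain f where f: "f ` S \<subseteq> verts G" "\<And>u v. u \<in> S \<Longrightarrow> v \<in> S \<Longrightarrow> gdist G (f u) (f v) = cheb u v"
    unfolding embeds_def by blast
  have fG: "f u \<in> verts G" if "u \<in> S" for u using f(1) that by blast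
  have inj: "inj_on f S"
  proof (rule inj_onI)
    fix u v assume uv: "u \<in> S" "v \<in> S" "f u = f v"
    then have "cheb u v = 0" using f(2)[OF uv(1,2)] gdist_refl[OF fG[OF uv(1)]] by simp
    then show "u = v" by (simp add: cheb_eq_0_iff)
  qed
  define K where "K = G \<restriction> f ` S"
  interpret K: wf_digraph K unfolding K_def by (rule wellformed_induce_subgraph)
  define g where "g = the_inv_into S f"
  have gf: "g (f u) = u" if "u \<in> S" for u using inj that by (simp add: g_def the_inv_into_f_f)
  \<comment> \<open>An arc of the king-grid is the pair of its ends, so an arc of \<open>K\<close>
    is renamed to the pair of the \<open>g\<close>-images of its ends; this is injective because
    \<open>G\<close> has no multiple arcs.\<close>
  define hom :: "('a, 'b, int \<times> int, (int \<times> int) \<times> (int \<times> int)) digraph_isomorphism" where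
    "hom = \<lparr>iso_verts = g, iso_arcs = (\<lambda>a. (g (tail G a), g (head G a))),
      iso_head = snd, iso_tail = fst\<rparr>"
  have hom: "K.digraph_isomorphism hom"
    unfolding K.digraph_isomorphism_def
  proof (intro conjI ballI)
    show "inj_on (iso_verts hom) (verts K)"
      using gf by (auto simp: hom_def K_def inj_on_def)
    show "inj_on (iso_arcs hom) (arcs K)"
    proof (rule inj_onI)
      fix a b assume ab: "a \<in> arcs K" "b \<in> arcs K" "iso_arcs hom a = iso_arcs hom b"
      then have "tail G a = tail G b" "head G a = head G b"
        using gf by (auto simp: hom_def K_def)
      then show "a = b" using ab no_multi_arcs by (auto simp: K_def arc_to_ends_def)
    qed
  qed (auto simp: hom_def K_def K.wf_digraph[unfolded K_def])
  have "king_grid \<restriction> S = app_iso hom K"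
  proof (rule pre_digraph.equality)
    show "verts (king_grid \<restriction> S) = verts (app_iso hom K)"
      using gf by (auto simp: hom_def K_def image_image)
    show "arcs (king_grid \<restriction> S) = arcs (app_iso hom K)"
    proof (intro set_eqI iffI)
      fix a assume "a \<in> arcs (king_grid \<restriction> S)"
      then have a: "fst a \<in> S" "snd a \<in> S" "cheb (fst a) (snd a) = 1"
        by (auto simp: king_grid_def cheb_def)
      then have "f (fst a) \<rightarrow> f (snd a)" using f(2) fG adj_iff_dist_eq_1 by simp
      then obtain e where "e \<in> arcs G" "tail G e = f (fst a)" "head G e = f (snd a)" by blast
      then show "a \<in> arcs (app_iso hom K)"
        using a gf[OF a(1)] gf[OF a(2)] by (auto simp: hom_def K_def intro!: image_eqI[of _ _ e])
    next
      fix a assume "a \<in> arcs (app_iso hom K)"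
      then obtain e u v where e: "e \<in> arcs G" "tail G e = f u" "head G e = f v" "u \<in> S" "v \<in> S"
        "a = (u, v)"
        using gf by (auto simp: hom_def K_def)
      then have "f u \<rightarrow> f v" using in_arcs_imp_in_arcs_ends by metis
      then have "cheb u v = 1" using e f(2) fG adj_iff_dist_eq_1 by simp
      then show "a \<in> arcs (king_grid \<restriction> S)"
        using e by (auto simp: king_grid_def cheb_def)
    qed
  qed (auto simp: king_grid_def hom_def)
  note iso = this
  have iso_dist: "gdist K (f u) (f v) = cheb u v" if "u \<in> S" "v \<in> S" for u v
    using K.gdist_app_iso[OF hom, of "f u" "f v"] gdist_king_grid_restrict(2)[OF S(1) that] that gf
    by (simp add: iso[symmetric]) (simp add: hom_def K_def)
  interpret H: wf_digraph "app_iso hom K" by (rule K.wf_digraphI_app_iso[OF hom])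
  have "connected (app_iso hom K)"
  proof (rule H.connectedI)
    show "verts (app_iso hom K) \<noteq> {}" using S(2) by (simp add: iso[symmetric])
    fix u v assume "u \<in> verts (app_iso hom K)" "v \<in> verts (app_iso hom K)"
    then show "u \<rightarrow>\<^sup>*\<^bsub>with_proj (mk_symmetric (app_iso hom K))\<^esub> v"
      using gdist_king_grid_restrict(1)[OF S(1)] by (intro H.reachable_mk_symmetricI) (simp add: iso[symmetric])
  qed
  then have "connected K"
    using H.connectedI_app_iso[OF _ K.digraph_isomorphism_invI[OF hom]] K.app_iso_inv[OF hom] by simp
  then have "isometric_subgraph K G"
    unfolding isometric_subgraph_def K_def
    using iso_dist f(2) induced_induce[OF f(1)] unfolding K_def by auto
  moreover have "digraph_iso K (king_grid \<restriction> S)"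
    unfolding digraph_iso_def using hom iso by blast
  ultimately show "contains_isometric G (king_grid \<restriction> S)"
    unfolding contains_isometric_def by blast
qed

section \<open>Wide quadruples in the plane\<close>

lemma sort3_top_gap:
  fixes p q r N :: nat
  assumes "N > 0" "xs = sort [p, q, r]"
  shows "xs ! 1 + N \<le> xs ! 2 \<longleftrightarrow>
    q + N \<le> p \<and> r + N \<le> p \<or> p + N \<le> q \<and> r + N \<le> q \<or> p + N \<le> r \<and> q + N \<le> r"
  using assms by auto

text \<open>\<open>a\<close>, \<open>c\<close> and \<open>b\<close>, \<open>d\<close> are the pairs with the largest distance sum.\<close>
definition (in pre_digraph) wide_quadruple :: "nat \<Rightarrow> 'a \<Rightarrow> 'a \<Rightarrow> 'a \<Rightarrow> 'a \<Rightarrow> bool" where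
  "wide_quadruple N a b c d \<longleftrightarrow> {a, b, c, d} \<subseteq> verts G \<and>
     gdist G a b + gdist G c d + N \<le> gdist G a c + gdist G b d \<and>
     gdist G a d + gdist G b c + N \<le> gdist G a c + gdist G b d"

context connected_graph
begin

text \<open>The gap between the two largest sums is an integer, so exceeding \<open>N - 1\<close>
  means reaching \<open>N\<close>. The disjuncts record which of the three sums is largest.\<close>

lemma less_quad_hb_iff:
  assumes V: "u \<in> verts G" "v \<in> verts G" "w \<in> verts G" "x \<in> verts G" and N: "N > 0"
  shows "(real N - 1) / 2 < quad_hb G u v w x \<longleftrightarrow>
    wide_quadruple N u w v x \<or> wide_quadruple N u v w x \<or> wide_quadruple N u v x w"
proof -
  define s where "s = sort [gdist G u v + gdist G w x, gdist G u w + gdist G v x, gdist G u x + gdist G v w]"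
  have halve: "(n - 1) / 2 < (z - y) / 2 \<longleftrightarrow> n + y < z + 1" for n y z :: real
    by auto
  have "(real N - 1) / 2 < quad_hb G u v w x \<longleftrightarrow> real N + real (s ! 1) < real (s ! 2) + 1"
    unfolding quad_hb_def Let_def s_def[symmetric] by (rule halve)
  also have "\<dots> \<longleftrightarrow> real (N + s ! 1) < real (s ! 2 + 1)"
    by (simp add: add_ac)
  also have "\<dots> \<longleftrightarrow> s ! 1 + N \<le> s ! 2"
    unfolding of_nat_less_iff by linarith
  finally show ?thesis
    using dist_sym[OF V(3,2)] dist_sym[OF V(4,3)] V
    unfolding sort3_top_gap[OF N s_def] wide_quadruple_def by (auto simp: add_ac)
qed

lemma less_hb_iff:
  assumes "N > 0"
  shows "(real N - 1) / 2 < hb G \<longleftrightarrow> (\<exists>a b c d. wide_quadruple N a b c d)"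
proof -
  let ?Q = "{quad_hb G u v w x | u v w x.
     u \<in> verts G \<and> v \<in> verts G \<and> w \<in> verts G \<and> x \<in> verts G}"
  have "?Q = (\<lambda>(u, v, w, x). quad_hb G u v w x) ` (verts G \<times> verts G \<times> verts G \<times> verts G)"
    by (auto simp: image_iff) blast
  then have fin: "finite ?Q" by simp
  have "verts G \<noteq> {}"
    using connected by (auto simp: connected_def strongly_connected_def)
  then have ne: "?Q \<noteq> {}" by blast
  have "(real N - 1) / 2 < hb G \<longleftrightarrow> (\<exists>q\<in>?Q. (real N - 1) / 2 < q)"
    unfolding hb_def using Max_gr_iff[OF fin ne] .
  also have "\<dots> \<longleftrightarrow> (\<exists>a b c d. wide_quadruple N a b c d)"
  proof
    assume "\<exists>q\<in>?Q. (real N - 1) / 2 < q"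
    then obtain u v w x where "u \<in> verts G" "v \<in> verts G" "w \<in> verts G" "x \<in> verts G"
      "(real N - 1) / 2 < quad_hb G u v w x" by blast
    then show "\<exists>a b c d. wide_quadruple N a b c d"
      using less_quad_hb_iff assms by blast
  next
    assume "\<exists>a b c d. wide_quadruple N a b c d"
    then obtain a b c d where w: "wide_quadruple N a b c d" by blast
    then have V: "a \<in> verts G" "b \<in> verts G" "c \<in> verts G" "d \<in> verts G"
      by (auto simp: wide_quadruple_def)
    have "(real N - 1) / 2 < quad_hb G a b c d"
      using less_quad_hb_iff[OF V assms] w by blast
    then show "\<exists>q\<in>?Q. (real N - 1) / 2 < q" using V by blast
  qed
  finally show ?thesis .
qed

end

section \<open>The pinwheel of a wide quadruple in the l1 plane\<close>

definition l1 :: "int \<times> int \<Rightarrow> int \<times> int \<Rightarrow> int" where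
  "l1 p q = \<bar>fst p - fst q\<bar> + \<bar>snd p - snd q\<bar>"

lemma l1_sym: "l1 p q = l1 q p"
  by (simp add: l1_def)

lemma l1_triangle: "l1 p r \<le> l1 p q + l1 q r"
  by (simp add: l1_def)

text \<open>Coordinate differences add up along a monotone sequence. Only the direction opposite to
  the triangle inequality is stated.\<close>

lemma l1_monotone:
  assumes "fst e \<le> fst p" "fst p \<le> fst q" "fst q \<le> fst e'"
    and "snd e \<le> snd p \<and> snd p \<le> snd q \<and> snd q \<le> snd e' \<or>
      snd e \<ge> snd p \<and> snd p \<ge> snd q \<and> snd q \<ge> snd e'"
  shows "l1 e p + l1 p q + l1 q e' \<le> l1 e e'"
  using assms(4) by (elim disjE) (use assms(1-3) in \<open>simp_all add: l1_def\<close>)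

text \<open>
  Geodesics of the \<open>l1\<close> plane are the monotone paths, so this expresses that \<open>p\<close>, \<open>q\<close> occur in
  this order on a geodesic joining two of the four points \<open>(-\<alpha>, T)\<close>, \<open>(0, -\<beta>)\<close>, \<open>(W + \<gamma>, 0)\<close>,
  \<open>(W, T + \<delta>)\<close>.
\<close>
definition pinwheel_chain ::
  "int \<Rightarrow> int \<Rightarrow> int \<Rightarrow> int \<Rightarrow> int \<Rightarrow> int \<Rightarrow> int \<times> int \<Rightarrow> int \<times> int \<Rightarrow> bool" where
  "pinwheel_chain W T \<alpha> \<beta> \<gamma> \<delta> p q \<longleftrightarrow> fst p \<le> fst q \<and>
    (0 \<le> fst p \<and> fst q \<le> W \<and> - \<beta> \<le> snd p \<and> snd p \<le> snd q \<and> snd q \<le> T + \<delta> \<or>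
     - \<alpha> \<le> fst p \<and> fst q \<le> W + \<gamma> \<and> T \<ge> snd p \<and> snd p \<ge> snd q \<and> snd q \<ge> 0 \<or>
     - \<alpha> \<le> fst p \<and> fst q \<le> 0 \<and> T \<ge> snd p \<and> snd p \<ge> snd q \<and> snd q \<ge> - \<beta> \<or>
     - \<alpha> \<le> fst p \<and> fst q \<le> W \<and> T \<le> snd p \<and> snd p \<le> snd q \<and> snd q \<le> T + \<delta> \<or>
     0 \<le> fst p \<and> fst q \<le> W + \<gamma> \<and> - \<beta> \<le> snd p \<and> snd p \<le> snd q \<and> snd q \<le> 0 \<or>
     W \<le> fst p \<and> fst q \<le> W + \<gamma> \<and> T + \<delta> \<ge> snd p \<and> snd p \<ge> snd q \<and> snd q \<ge> 0)"

definition pinwheel_linked ::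
  "int \<Rightarrow> int \<Rightarrow> int \<Rightarrow> int \<Rightarrow> int \<Rightarrow> int \<Rightarrow> int \<times> int \<Rightarrow> int \<times> int \<Rightarrow> bool" where
  "pinwheel_linked W T \<alpha> \<beta> \<gamma> \<delta> p q \<longleftrightarrow>
     pinwheel_chain W T \<alpha> \<beta> \<gamma> \<delta> p q \<or> pinwheel_chain W T \<alpha> \<beta> \<gamma> \<delta> q p"

text \<open>Packages what the Helly property yields, so that embedding a piece becomes a placement
  problem in the plane. The parity condition selects the class of the corner
  \<open>(0, - \<beta>)\<close>, where \<open>l1\<close> distances are even and can be
  halved.\<close>

definition (in pre_digraph) realizes_pinwheel ::
  "int \<Rightarrow> int \<Rightarrow> int \<Rightarrow> int \<Rightarrow> int \<Rightarrow> int \<Rightarrow> bool" where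
  "realizes_pinwheel W T \<alpha> \<beta> \<gamma> \<delta> \<longleftrightarrow> (\<forall>S \<phi>. finite S \<longrightarrow>
     (\<forall>u\<in>S. even (fst (\<phi> u) + snd (\<phi> u) + \<beta>)) \<longrightarrow>
     (\<forall>u\<in>S. \<forall>v\<in>S. pinwheel_linked W T \<alpha> \<beta> \<gamma> \<delta> (\<phi> u) (\<phi> v)) \<longrightarrow>
     (\<forall>u\<in>S. \<forall>v\<in>S. l1 (\<phi> u) (\<phi> v) = 2 * int (cheb u v)) \<longrightarrow> embeds S)"

lemma (in pre_digraph) realizes_pinwheelD:
  assumes "realizes_pinwheel W T \<alpha> \<beta> \<gamma> \<delta>" "finite S"
    and "\<And>u. u \<in> S \<Longrightarrow> even (fst (\<phi> u) + snd (\<phi> u) + \<beta>)"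
    and "\<And>u v. u \<in> S \<Longrightarrow> v \<in> S \<Longrightarrow> pinwheel_linked W T \<alpha> \<beta> \<gamma> \<delta> (\<phi> u) (\<phi> v)"
    and "\<And>u v. u \<in> S \<Longrightarrow> v \<in> S \<Longrightarrow> l1 (\<phi> u) (\<phi> v) = 2 * int (cheb u v)"
  shows "embeds S"
  using assms(1)[unfolded realizes_pinwheel_def, rule_format, of S \<phi>] assms(2-5) by blast

lemma (in connected_graph) wide_quadruple_pinwheelE:
  assumes helly: "helly G" and wide: "wide_quadruple N a b c d" and N: "N > 0"
  obtains W T \<alpha> \<beta> \<gamma> \<delta> where "int N \<le> W" "int N \<le> T" "\<alpha> \<ge> 0" "\<beta> \<ge> 0" "\<gamma> \<ge> 0" "\<delta> \<ge> 0"
    "even (T + \<alpha> + \<beta>)" "even (W + \<gamma> + \<beta>)" "even (W + T + \<delta> + \<beta>)"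
    "realizes_pinwheel W T \<alpha> \<beta> \<gamma> \<delta>"
proof -
  have V: "a \<in> verts G" "b \<in> verts G" "c \<in> verts G" "d \<in> verts G"
    using wide by (auto simp: wide_quadruple_def)
  define D where "D x y = int (gdist G x y)" for x y
  have sym: "D x y = D y x" if "x \<in> verts G" "y \<in> verts G" for x y
    using dist_sym[OF that] by (simp add: D_def)
  have tri: "D x z \<le> D x y + D y z" if "x \<in> verts G" "y \<in> verts G" "z \<in> verts G" for x y z
    using dist_triangle[OF that] by (simp add: D_def)
  \<comment> \<open>\<open>W\<close> and \<open>T\<close> are the gaps from the largest sum to the
    other two. Each whisker is the slack of the triangle inequality through its vertex between the
    two neighbours in the cyclic order \<open>a\<close>, \<open>b\<close>, \<open>c\<close>,
    \<open>d\<close>, that is, twice a Gromov product.\<close>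
  define W where "W = D a c + D b d - D a b - D c d"
  define T where "T = D a c + D b d - D a d - D b c"
  define \<alpha> where "\<alpha> = D a b + D a d - D b d"
  define \<beta> where "\<beta> = D a b + D b c - D a c"
  define \<gamma> where "\<gamma> = D b c + D c d - D b d"
  define \<delta> where "\<delta> = D a d + D c d - D a c"
  note defs = W_def T_def \<alpha>_def \<beta>_def \<gamma>_def \<delta>_def
  have WT: "int N \<le> W" "int N \<le> T"
    using wide by (simp_all add: wide_quadruple_def defs D_def)
  have nonneg: "\<alpha> \<ge> 0" "\<beta> \<ge> 0" "\<gamma> \<ge> 0" "\<delta> \<ge> 0"
    using tri[OF V(2,1,4)] tri[OF V(1,2,3)] tri[OF V(2,3,4)] tri[OF V(1,4,3)]
      sym[OF V(2,1)] sym[OF V(4,3)] by (simp_all add: defs)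
  \<comment> \<open>The sums collapse to \<open>2 * D a b\<close>, \<open>2 * D b c\<close> and
    \<open>2 * D b d\<close>, so the four corners lie in one parity class.\<close>
  have parity: "even (T + \<alpha> + \<beta>)" "even (W + \<gamma> + \<beta>)" "even (W + T + \<delta> + \<beta>)"
    by (simp_all add: defs)
  define A B C E :: "int \<times> int" where pts: "A = (- \<alpha>, T)" "B = (0, - \<beta>)" "C = (W + \<gamma>, 0)" "E = (W, T + \<delta>)"
  have dists: "l1 A B = 2 * D a b" "l1 A C = 2 * D a c" "l1 A E = 2 * D a d"
    "l1 B C = 2 * D b c" "l1 B E = 2 * D b d" "l1 C E = 2 * D c d"
    using WT N nonneg unfolding l1_def pts by (simp_all add: defs)
  \<comment> \<open>Positive \<open>W\<close> and \<open>T\<close> separate the corners, so the case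
    distinction in \<open>corner\<close> sends each to its own vertex.\<close>
  have distinct: "A \<noteq> B" "A \<noteq> C" "A \<noteq> E" "B \<noteq> C" "B \<noteq> E" "C \<noteq> E"
    using WT N nonneg unfolding pts by auto
  define corner where "corner p = (if p = A then a else if p = B then b else if p = C then c else d)" for p
  have corner_simps: "corner A = a" "corner B = b" "corner C = c" "corner E = d"
    using distinct by (auto simp: corner_def)
  have corner_dist: "l1 p q = 2 * D (corner p) (corner q)"
    if "p \<in> {A, B, C, E}" "q \<in> {A, B, C, E}" for p q
  proof -
    have refl: "D x x = 0" if "x \<in> verts G" for x using gdist_refl[OF that] by (simp add: D_def)
    note flipped = dists[THEN trans[OF l1_sym]]
    have "l1 p p = 0" for p by (simp add: l1_def)
    then show ?thesis
      using that by (elim insertE emptyE)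
        (simp_all add: corner_simps dists flipped refl V sym[OF V(2,1)] sym[OF V(3,1)] sym[OF V(4,1)]
          sym[OF V(3,2)] sym[OF V(4,2)] sym[OF V(4,3)])
  qed
  show ?thesis
  proof (rule that[OF WT nonneg parity], unfold realizes_pinwheel_def, intro allI impI)
    fix S :: "(int \<times> int) set" and \<phi> :: "int \<times> int \<Rightarrow> int \<times> int"
    assume fin: "finite S" and even: "\<forall>u\<in>S. even (fst (\<phi> u) + snd (\<phi> u) + \<beta>)"
      and "\<forall>u\<in>S. \<forall>v\<in>S. pinwheel_linked W T \<alpha> \<beta> \<gamma> \<delta> (\<phi> u) (\<phi> v)"
      and "\<forall>u\<in>S. \<forall>v\<in>S. l1 (\<phi> u) (\<phi> v) = 2 * int (cheb u v)"
    then have chain: "\<And>u v. u \<in> S \<Longrightarrow> v \<in> S \<Longrightarrow> pinwheel_chain W T \<alpha> \<beta> \<gamma> \<delta> (\<phi> u) (\<phi> v) \<or>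
        pinwheel_chain W T \<alpha> \<beta> \<gamma> \<delta> (\<phi> v) (\<phi> u)"
      and iso: "\<And>u v. u \<in> S \<Longrightarrow> v \<in> S \<Longrightarrow> l1 (\<phi> u) (\<phi> v) = 2 * int (cheb u v)"
      by (simp_all add: pinwheel_linked_def)
    define X where "X = {A, B, C, E} \<union> \<phi> ` S"
    define \<rho> where "\<rho> p q = nat (l1 p q div 2)" for p q
    have even_X: "even (fst p + snd p + \<beta>)" if "p \<in> X" for p
    proof (cases "p \<in> \<phi> ` S")
      case False
      then have "p \<in> {A, B, C, E}" using that by (simp add: X_def)
      moreover have parity': "even (- \<alpha> + T + \<beta>)" "even (0 + - \<beta> + \<beta>)" "even (W + \<gamma> + 0 + \<beta>)"
        "even (W + (T + \<delta>) + \<beta>)"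
        using parity by presburger+
      ultimately show ?thesis by (elim insertE emptyE) (simp_all only: pts fst_conv snd_conv)
    qed (use even in auto)
    have \<rho>: "l1 p q = 2 * int (\<rho> p q)" if "p \<in> X" "q \<in> X" for p q
    proof -
      have "even (l1 p q)" using even_X[OF that(1)] even_X[OF that(2)] unfolding l1_def by simp presburger
      then show ?thesis by (auto simp: \<rho>_def l1_def)
    qed
    have corners_X: "p \<in> X" if "p \<in> {A, B, C, E}" for p
      using that by (auto simp: X_def)
    obtain g where g: "\<And>x. x \<in> X \<Longrightarrow> g x \<in> verts G"
      "\<And>x y. x \<in> X \<Longrightarrow> y \<in> X \<Longrightarrow> gdist G (g x) (g y) \<le> \<rho> x y"
      "\<And>y. y \<in> {A, B, C, E} \<Longrightarrow> g y = corner y"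
    proof (rule helly_extension[OF helly, of \<rho> X "{A, B, C, E}" corner])
      show "\<rho> x y = \<rho> y x" for x y by (simp add: \<rho>_def l1_sym)
      show "\<rho> x z \<le> \<rho> x y + \<rho> y z" if "x \<in> X" "y \<in> X" "z \<in> X" for x y z
        using l1_triangle[of x z y] \<rho> that by fastforce
      show "gdist G (corner y) (corner z) \<le> \<rho> y z" if "y \<in> {A, B, C, E}" "z \<in> {A, B, C, E}" for y z
        using corner_dist[OF that] \<rho>[OF corners_X corners_X, OF that] by (simp add: D_def)
    qed (use fin V in \<open>auto simp: X_def corner_def\<close>)
    have upper: "2 * D (g p) (g q) \<le> l1 p q" if "p \<in> X" "q \<in> X" for p q
      using g(2)[OF that] \<rho>[OF that] by (simp add: D_def)
    \<comment> \<open>The map is exact between the corners \<open>e\<close> and \<open>e'\<close>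
      and nonexpansive on the two outer segments, so the middle segment cannot shrink.\<close>
    have lower: "l1 p q \<le> 2 * D (g p) (g q)"
      if "p \<in> X" "q \<in> X" "e \<in> {A, B, C, E}" "e' \<in> {A, B, C, E}"
        "l1 e p + l1 p q + l1 q e' \<le> l1 e e'" for p q e e'
    proof -
      have X: "e \<in> X" "e' \<in> X" using that by (simp_all add: corners_X)
      have "l1 e e' = 2 * D (g e) (g e')"
        using corner_dist[OF that(3,4)] g(3)[OF that(3)] g(3)[OF that(4)] by simp
      also have "\<dots> \<le> 2 * (D (g e) (g p) + D (g p) (g q) + D (g q) (g e'))"
        using tri[OF g(1) g(1) g(1), OF X(1) that(1) X(2)] tri[OF g(1) g(1) g(1), OF that(1,2) X(2)]
        by simp
      finally show ?thesis
        using upper[OF X(1) that(1)] upper[OF that(2) X(2)] that(5) by (simp add: algebra_simps)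
    qed
    have lower': "l1 p q \<le> 2 * D (g p) (g q)"
      if X: "p \<in> X" "q \<in> X" and pq: "pinwheel_chain W T \<alpha> \<beta> \<gamma> \<delta> p q" for p q
    proof -
      \<comment> \<open>The disjuncts of \<open>pinwheel_chain\<close> are, in order, the geodesics
        from \<open>B\<close> to \<open>E\<close>, \<open>A\<close> to \<open>C\<close>,
        \<open>A\<close> to \<open>B\<close>, \<open>A\<close> to \<open>E\<close>, \<open>B\<close>
        to \<open>C\<close> and \<open>E\<close> to \<open>C\<close>.\<close>
      from pq show ?thesis
        unfolding pinwheel_chain_def
        apply (elim conjE disjE)
        subgoal by (rule lower[OF X, of B E]; (rule l1_monotone)?) (simp_all add: pts)
        subgoal by (rule lower[OF X, of A C]; (rule l1_monotone)?) (simp_all add: pts)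
        subgoal by (rule lower[OF X, of A B]; (rule l1_monotone)?) (simp_all add: pts)
        subgoal by (rule lower[OF X, of A E]; (rule l1_monotone)?) (simp_all add: pts)
        subgoal by (rule lower[OF X, of B C]; (rule l1_monotone)?) (simp_all add: pts)
        subgoal by (rule lower[OF X, of E C]; (rule l1_monotone)?) (simp_all add: pts)
        done
    qed
    have S_X: "\<phi> u \<in> X" if "u \<in> S" for u using that by (simp add: X_def)
    show "embeds S"
      unfolding embeds_def
    proof (intro exI[of _ "g \<circ> \<phi>"] conjI ballI)
      show "(g \<circ> \<phi>) ` S \<subseteq> verts G" using g(1) S_X by (simp add: image_subset_iff)
      fix u v assume uv: "u \<in> S" "v \<in> S"
      then have X: "\<phi> u \<in> X" "\<phi> v \<in> X" by (simp_all add: S_X)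
      have "l1 (\<phi> u) (\<phi> v) \<le> 2 * D (g (\<phi> u)) (g (\<phi> v))"
        using chain[OF uv] lower'[OF X] lower'[OF X(2,1)] l1_sym[of "\<phi> v" "\<phi> u"]
          sym[OF g(1) g(1), OF X(2,1)] by auto
      with upper[OF X] iso[OF uv] show "gdist G ((g \<circ> \<phi>) u) ((g \<circ> \<phi>) v) = cheb u v"
        by (simp add: D_def)
    qed
  qed
qed

section \<open>Convexity of the three grid pieces\<close>

definition st :: "int \<times> int \<Rightarrow> int \<times> int" where
  "st u = (fst u + snd u, fst u - snd u)"

lemma l1_st: "l1 (st u) (st v) = 2 * int (cheb u v)"
  by (simp add: two_cheb l1_def st_def)

lemma l1_st_pair: "l1 (st (x, y)) (st (x', y')) = \<bar>(x + y) - (x' + y')\<bar> + \<bar>(x - y) - (x' - y')\<bar>"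
  by (simp add: l1_def st_def)

lemma cheb_sym: "cheb u v = cheb v u"
  by (simp add: cheb_def abs_minus_commute)

lemma cheb_stepI:
  assumes "l1 (st u) (st w) = 2" "l1 (st u) (st v) = 2 + l1 (st w) (st v)"
  shows "cheb u w = 1 \<and> cheb u v = Suc (cheb w v)"
  using assms by (simp add: l1_st)

text \<open>A king move by the signs of the coordinate differences keeps s and t between their
  values at the two ends, hence inside the box. In pairs meeting \<open>E\<close> the move starts at
  the extra vertex.\<close>

lemma menger_convexI:
  assumes box: "\<And>u. u \<in> S - E \<longleftrightarrow> lo \<le> fst u + snd u \<and> fst u + snd u \<le> hi \<and> lo' \<le> fst u - snd u \<and> fst u - snd u \<le> hi'"
    and extra: "\<And>u v. u \<in> E \<Longrightarrow> v \<in> S \<Longrightarrow> u \<noteq> v \<Longrightarrow> \<exists>w\<in>S. l1 (st u) (st w) = 2 \<and> l1 (st u) (st v) = 2 + l1 (st w) (st v)"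
  shows "menger_convex S"
  unfolding menger_convex_def
proof (intro ballI impI)
  fix u v assume uv: "u \<in> S" "v \<in> S" "u \<noteq> v"
  consider "u \<in> E" | "v \<in> E" | "u \<notin> E" "v \<notin> E" by blast
  then show "\<exists>w\<in>S. cheb u w = 1 \<and> cheb u v = Suc (cheb w v) \<or> cheb w v = 1 \<and> cheb u v = Suc (cheb u w)"
  proof cases
    case 1
    then show ?thesis using extra[OF 1 uv(2,3)] cheb_stepI by blast
  next
    case 2
    then obtain w where "w \<in> S" "cheb v w = 1" "cheb v u = Suc (cheb w u)"
      using extra[OF 2 uv(1)] uv(3) cheb_stepI by blast
    then show ?thesis by (metis cheb_sym)
  next
    case 3
    define w where "w = (fst u + sgn (fst v - fst u), snd u + sgn (snd v - snd u))"
    have u: "u \<in> S - E" and v: "v \<in> S - E" using uv 3 by auto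
    have "w \<in> S - E"
      using u v unfolding box w_def by (auto simp: sgn_if)
    moreover have "fst u \<noteq> fst v \<or> snd u \<noteq> snd v"
      using uv(3) by (simp add: prod_eq_iff)
    then have "cheb u w = 1" "cheb u v = Suc (cheb w v)"
      by (auto simp: cheb_def w_def sgn_if)
    ultimately show ?thesis by blast
  qed
qed

lemma in_verts_H1: "u \<in> verts (H1 m) \<longleftrightarrow>
    0 \<le> fst (st u) \<and> fst (st u) \<le> 2 * int m \<and> 0 \<le> snd (st u) \<and> snd (st u) \<le> 2 * int m"
  by (auto simp: H1_def st_def split: prod.splits)

lemma in_verts_H2: "u \<in> verts (H2 m) \<longleftrightarrow>
    0 \<le> fst (st u) \<and> fst (st u) \<le> 2 * int m + 1 \<and> - 1 \<le> snd (st u) \<and> snd (st u) \<le> 2 * int m \<or>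
    u \<in> {(- 1, 0), (2 * int m + 1, 1)}"
  by (auto simp: H2_def st_def split: prod.splits)

lemma in_verts_H3: "u \<in> verts (H3 m) \<longleftrightarrow>
    0 \<le> fst (st u) \<and> fst (st u) \<le> 2 * int m + 2 \<and> - 1 \<le> snd (st u) \<and> snd (st u) \<le> 2 * int m + 1 \<or>
    u \<in> {(int m, - int m - 1), (- 1, 1), (int m + 1, int m + 2), (2 * int m + 2, 0)}"
  by (auto simp: H3_def st_def split: prod.splits)

lemma menger_convex_H1: "menger_convex (verts (H1 m))"
  by (rule menger_convexI[where E = "{}" and lo' = 0 and hi' = "2 * int m"]) (auto simp: in_verts_H1 st_def)

lemma menger_convex_H2: "menger_convex (verts (H2 m))"
proof (rule menger_convexI[where E = "{(- 1, 0), (2 * int m + 1, 1)}"])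
  show "u \<in> verts (H2 m) - {(- 1, 0), (2 * int m + 1, 1)} \<longleftrightarrow> 0 \<le> fst u + snd u \<and>
    fst u + snd u \<le> 2 * int m + 1 \<and> - 1 \<le> fst u - snd u \<and> fst u - snd u \<le> 2 * int m" for u
    by (auto simp: in_verts_H2 st_def)
  fix u v :: "int \<times> int"
  assume u: "u \<in> {(- 1, 0), (2 * int m + 1, 1)}" and v: "v \<in> verts (H2 m)" "u \<noteq> v"
  \<comment> \<open>In (s, t) the extra vertices are \<open>(- 1, - 1)\<close> and
    \<open>(2 * int m + 2, 2 * int m)\<close>, one unit beyond a box corner along s. If
    \<open>v\<close> has the same t as \<open>u\<close>, the move goes two units along s, otherwise
    one unit in each of s and t.\<close>
  define w :: "int \<times> int" where "w = (if u = (- 1, 0) then if snd (st v) = - 1 then (0, 1) else (0, 0)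
    else if snd (st v) = 2 * int m then (2 * int m, 0) else (2 * int m, 1))"
  have "w \<in> verts (H2 m)"
    by (auto simp: w_def in_verts_H2 st_def)
  moreover have "l1 (st u) (st w) = 2"
    using u by (auto simp: w_def l1_def st_def)
  moreover have "l1 (st u) (st v) = 2 + l1 (st w) (st v)"
  proof -
    obtain x y where xy: "v = (x, y)" by (cases v)
    have "0 \<le> x + y \<and> x + y \<le> 2 * int m + 1 \<and> - 1 \<le> x - y \<and> x - y \<le> 2 * int m \<or>
      x = - 1 \<and> y = 0 \<or> x = 2 * int m + 1 \<and> y = 1"
      using v(1) by (simp add: in_verts_H2 st_def xy)
    note v_cases = this
    \<comment> \<open>s and t have equal parity at grid points, so \<open>v\<close> is not the box
      corner next to \<open>u\<close>, which the move along s would overshoot.\<close>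
    have parity: "x - y = - 1 \<Longrightarrow> x + y \<noteq> 0" "x - y = 2 * int m \<Longrightarrow> x + y \<noteq> 2 * int m + 1"
      by presburger+
    have w: "w = (if u = (- 1, 0) then if x - y = - 1 then (0, 1) else (0, 0)
      else if x - y = 2 * int m then (2 * int m, 0) else (2 * int m, 1))"
      by (simp add: w_def st_def xy)
    from u show ?thesis
      by (elim insertE emptyE; use v_cases v(2) w in
          \<open>auto simp: xy l1_st_pair split: if_splits; use parity in \<open>smt (verit)\<close>\<close>)
  qed
  ultimately show "\<exists>w\<in>verts (H2 m). l1 (st u) (st w) = 2 \<and> l1 (st u) (st v) = 2 + l1 (st w) (st v)"
    by blast
qed

lemma menger_convex_H3: "menger_convex (verts (H3 m))"
proof (rule menger_convexI[where
      E = "{(int m, - int m - 1), (- 1, 1), (int m + 1, int m + 2), (2 * int m + 2, 0)}"])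
  let ?E = "{(int m, - int m - 1), (- 1, 1), (int m + 1, int m + 2), (2 * int m + 2, 0)}"
  show "u \<in> verts (H3 m) - ?E \<longleftrightarrow> 0 \<le> fst u + snd u \<and>
    fst u + snd u \<le> 2 * int m + 2 \<and> - 1 \<le> fst u - snd u \<and> fst u - snd u \<le> 2 * int m + 1" for u
    by (auto simp: in_verts_H3 st_def)
  fix u v :: "int \<times> int"
  assume u: "u \<in> ?E" and v: "v \<in> verts (H3 m)" "u \<noteq> v"
  \<comment> \<open>Each extra vertex is one unit beyond a box corner:
    \<open>(int m, - int m - 1)\<close> and \<open>(int m + 1, int m + 2)\<close> along s, the other
    two along t. The move goes straight back by two units if \<open>v\<close> is on or past the line
    of that side, otherwise diagonally; the inequalities cover targets that are themselves extra
    vertices.\<close>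
  define w :: "int \<times> int" where "w =
    (if u = (int m, - int m - 1) then if snd (st v) \<ge> 2 * int m + 1 then (int m + 1, - int m) else (int m, - int m)
     else if u = (- 1, 1) then if fst (st v) \<le> 0 then (0, 0) else (0, 1)
     else if u = (2 * int m + 2, 0) then
       if fst (st v) \<ge> 2 * int m + 2 then (2 * int m + 1, 1) else (2 * int m + 1, 0)
     else if snd (st v) \<le> - 1 then (int m, int m + 1) else (int m + 1, int m + 1))"
  have "w \<in> verts (H3 m)"
    by (auto simp: w_def in_verts_H3 st_def)
  moreover have "l1 (st u) (st w) = 2"
    using u by (auto simp: w_def l1_def st_def)
  moreover have "l1 (st u) (st v) = 2 + l1 (st w) (st v)"
  proof -
    obtain x y where xy: "v = (x, y)" by (cases v)
    have "0 \<le> x + y \<and> x + y \<le> 2 * int m + 2 \<and> - 1 \<le> x - y \<and> x - y \<le> 2 * int m + 1 \<or>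
      x = int m \<and> y = - int m - 1 \<or> x = - 1 \<and> y = 1 \<or> x = int m + 1 \<and> y = int m + 2 \<or>
      x = 2 * int m + 2 \<and> y = 0"
      using v(1) by (simp add: in_verts_H3 st_def xy)
    note v_cases = this
    have parity: "x - y = - 1 \<Longrightarrow> x + y \<noteq> 0 \<and> x + y \<noteq> 2 * int m + 2"
      "x - y = 2 * int m + 1 \<Longrightarrow> x + y \<noteq> 0 \<and> x + y \<noteq> 2 * int m + 2"
      by presburger+
    have w: "w = (if u = (int m, - int m - 1) then if x - y \<ge> 2 * int m + 1 then (int m + 1, - int m) else (int m, - int m)
      else if u = (- 1, 1) then if x + y \<le> 0 then (0, 0) else (0, 1)
      else if u = (2 * int m + 2, 0) then
        if x + y \<ge> 2 * int m + 2 then (2 * int m + 1, 1) else (2 * int m + 1, 0)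
      else if x - y \<le> - 1 then (int m, int m + 1) else (int m + 1, int m + 1))"
      by (simp add: w_def st_def xy)
    from u show ?thesis
      by (elim insertE emptyE; use v_cases v(2) w in
          \<open>auto simp: xy l1_st_pair split: if_splits; use parity in \<open>smt (verit)\<close>\<close>)
  qed
  ultimately show "\<exists>w\<in>verts (H3 m). l1 (st u) (st w) = 2 \<and> l1 (st u) (st v) = 2 + l1 (st w) (st v)"
    by blast
qed

section \<open>Embedding the grid pieces\<close>

definition in_box :: "int \<Rightarrow> int \<times> int \<Rightarrow> bool" where
  "in_box N p \<longleftrightarrow> 0 \<le> fst p \<and> fst p \<le> N \<and> 0 \<le> snd p \<and> snd p \<le> N"

lemma pinwheel_linked_sym:
  "pinwheel_linked W T \<alpha> \<beta> \<gamma> \<delta> p q \<longleftrightarrow> pinwheel_linked W T \<alpha> \<beta> \<gamma> \<delta> q p"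
  by (auto simp: pinwheel_linked_def)

text \<open>If both coordinates change in the same direction, the pair lies on a geodesic from
  \<open>(0, - \<beta>)\<close> to \<open>(W, T + \<delta>)\<close>; otherwise it lies on one from
  \<open>(- \<alpha>, T)\<close> to \<open>(W + \<gamma>, 0)\<close>.\<close>

lemma pinwheel_linked_box:
  assumes "0 \<le> \<alpha>" "0 \<le> \<beta>" "0 \<le> \<gamma>" "0 \<le> \<delta>"
    and "0 \<le> fst p" "fst p \<le> W" "0 \<le> snd p" "snd p \<le> T"
    and "0 \<le> fst q" "fst q \<le> W" "0 \<le> snd q" "snd q \<le> T"
  shows "pinwheel_linked W T \<alpha> \<beta> \<gamma> \<delta> p q"
  using assms unfolding pinwheel_linked_def pinwheel_chain_def
  by (cases "fst p \<le> fst q"; cases "snd p \<le> snd q") simp_all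

text \<open>The square fills the rectangle, and the four extra points are the first lattice points
  along the whiskers. Two of them lie on a geodesic joining their corners.\<close>

lemma pinwheel_linked_H3:
  assumes "2 \<le> N" "1 \<le> \<alpha>" "1 \<le> \<beta>" "1 \<le> \<gamma>" "1 \<le> \<delta>"
    and p: "in_box N p \<or> p \<in> {(- 1, N), (0, - 1), (N + 1, 0), (N, N + 1)}"
    and q: "in_box N q \<or> q \<in> {(- 1, N), (0, - 1), (N + 1, 0), (N, N + 1)}"
  shows "pinwheel_linked N N \<alpha> \<beta> \<gamma> \<delta> p q"
proof -
  have extra: "pinwheel_linked N N \<alpha> \<beta> \<gamma> \<delta> p q"
    if "p \<in> {(- 1, N), (0, - 1), (N + 1, 0), (N, N + 1)}"
      "in_box N q \<or> q \<in> {(- 1, N), (0, - 1), (N + 1, 0), (N, N + 1)}" for p q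
    by (insert that, (elim disjE insertE emptyE;
        use assms(1-5) in \<open>simp add: pinwheel_linked_def pinwheel_chain_def in_box_def\<close>))
  show ?thesis
  proof (cases "in_box N p \<and> in_box N q")
    case True
    then show ?thesis using assms(2-5) by (intro pinwheel_linked_box) (auto simp: in_box_def)
  qed (use extra p q pinwheel_linked_sym in metis)
qed

text \<open>
  Points are given by \<open>(s, t + 1)\<close>, which makes the bulk of \<open>H2 m\<close> the odd points of the square
  \<open>[0, N]\<^sup>2\<close>, \<open>N = 2 * m + 1\<close>, and its two extra vertices \<open>(- 1, 0)\<close> and \<open>(N + 1, N)\<close>. Turning an
  extra vertex around its corner, as from \<open>(- 1, 0)\<close> to \<open>(0, - 1)\<close>, preserves all distances to the
  square; the even placement reflects the square to change the parity.
\<close>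
definition place_H2_odd :: "int \<Rightarrow> bool \<Rightarrow> int \<times> int \<Rightarrow> int \<times> int" where
  "place_H2_odd N turn p =
     (if p = (- 1, 0) then (0, - 1) else if turn \<and> p = (N + 1, N) then (N, N + 1) else p)"

definition place_H2_even :: "int \<Rightarrow> bool \<Rightarrow> int \<times> int \<Rightarrow> int \<times> int" where
  "place_H2_even N turn p =
     (if turn \<and> p = (- 1, 0) then (0, N + 1) else (fst p, N - snd p))"

lemma place_H2_isometry:
  assumes "1 \<le> N"
    and "in_box N p \<or> p \<in> {(- 1, 0), (N + 1, N)}" "in_box N q \<or> q \<in> {(- 1, 0), (N + 1, N)}"
  shows "l1 (place_H2_odd N turn p) (place_H2_odd N turn q) = l1 p q"
    "l1 (place_H2_even N turn p) (place_H2_even N turn q) = l1 p q"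
  by (insert assms, cases p, cases q, (elim disjE insertE emptyE;
      simp add: l1_def place_H2_odd_def place_H2_even_def in_box_def))+

text \<open>Pairs with an extra vertex are handled on geodesics from \<open>(0, - \<beta>)\<close>
  to \<open>(W, T + \<delta>)\<close>: \<open>(0, - 1)\<close> precedes the square, and
  \<open>(N + 1, N)\<close> or its turned version \<open>(N, N + 1)\<close> follows it, depending on
  where there is room.\<close>

lemma pinwheel_linked_place_H2_odd:
  assumes "1 \<le> N" "N \<le> W" "N \<le> T" "0 \<le> \<alpha>" "1 \<le> \<beta>" "0 \<le> \<gamma>" "0 \<le> \<delta>"
    and turn: "if turn then N + 1 \<le> T + \<delta> else N + 1 \<le> W"
    and p: "in_box N p \<or> p \<in> {(- 1, 0), (N + 1, N)}"
    and q: "in_box N q \<or> q \<in> {(- 1, 0), (N + 1, N)}"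
  shows "pinwheel_linked W T \<alpha> \<beta> \<gamma> \<delta> (place_H2_odd N turn p) (place_H2_odd N turn q)"
proof -
  let ?L = "\<lambda>p q. pinwheel_linked W T \<alpha> \<beta> \<gamma> \<delta> (place_H2_odd N turn p) (place_H2_odd N turn q)"
  have extra: "?L p q"
    if "p \<in> {(- 1, 0), (N + 1, N)}" "in_box N q \<or> q \<in> {(- 1, 0), (N + 1, N)}" for p q
    by (insert that, cases q, (elim disjE insertE emptyE; use assms(1-8) in
        \<open>cases turn; simp add: pinwheel_linked_def pinwheel_chain_def in_box_def place_H2_odd_def\<close>))
  show ?thesis
  proof (cases "in_box N p \<and> in_box N q")
    case True
    then show ?thesis
      using assms(1-7) by (intro pinwheel_linked_box) (cases p; cases q; simp add: in_box_def place_H2_odd_def)+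
  qed (use extra p q pinwheel_linked_sym in metis)
qed

text \<open>After the reflection the relevant geodesics run from \<open>(- \<alpha>, T)\<close> to
  \<open>(W + \<gamma>, 0)\<close>: \<open>(- 1, N)\<close> or its turned version
  \<open>(0, N + 1)\<close> precedes the square, and \<open>(N + 1, 0)\<close> follows it.\<close>

lemma pinwheel_linked_place_H2_even:
  assumes "1 \<le> N" "N \<le> W" "N \<le> T" "0 \<le> \<alpha>" "0 \<le> \<beta>" "0 \<le> \<gamma>" "0 \<le> \<delta>" "N + 1 \<le> W + \<gamma>"
    and turn: "if turn then N + 1 \<le> T else 1 \<le> \<alpha>"
    and p: "in_box N p \<or> p \<in> {(- 1, 0), (N + 1, N)}"
    and q: "in_box N q \<or> q \<in> {(- 1, 0), (N + 1, N)}"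
  shows "pinwheel_linked W T \<alpha> \<beta> \<gamma> \<delta> (place_H2_even N turn p) (place_H2_even N turn q)"
proof -
  let ?L = "\<lambda>p q. pinwheel_linked W T \<alpha> \<beta> \<gamma> \<delta> (place_H2_even N turn p) (place_H2_even N turn q)"
  have extra: "?L p q"
    if "p \<in> {(- 1, 0), (N + 1, N)}" "in_box N q \<or> q \<in> {(- 1, 0), (N + 1, N)}" for p q
    by (insert that, cases q, (elim disjE insertE emptyE; use assms(1-9) in
        \<open>cases turn; simp add: pinwheel_linked_def pinwheel_chain_def in_box_def place_H2_even_def\<close>))
  show ?thesis
  proof (cases "in_box N p \<and> in_box N q")
    case True
    then show ?thesis
      using assms(1-7) by (intro pinwheel_linked_box) (cases p; cases q; simp add: in_box_def place_H2_even_def)+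
  qed (use extra p q pinwheel_linked_sym in metis)
qed

lemma finite_st_box:
  assumes "\<And>u. u \<in> S \<Longrightarrow> \<bar>fst (st u)\<bar> \<le> M \<and> \<bar>snd (st u)\<bar> \<le> M"
  shows "finite S"
proof (rule finite_subset)
  show "S \<subseteq> {- M..M} \<times> {- M..M}"
    using assms by (force simp: st_def abs_le_iff)
qed simp

lemma finite_verts_H1: "finite (verts (H1 m))"
  by (rule finite_st_box[where M = "2 * int m"]) (auto simp: in_verts_H1)

lemma finite_verts_H2: "finite (verts (H2 m))"
  by (rule finite_st_box[where M = "2 * int m + 2"]) (auto simp: in_verts_H2 st_def)

lemma finite_verts_H3: "finite (verts (H3 m))"
  by (rule finite_st_box[where M = "2 * int m + 3"]) (auto simp: in_verts_H3 st_def)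

section \<open>Wide quadruples and copies of the three pieces\<close>

context connected_graph
begin

lemma contains_H1_iff: "contains_isometric G (H1 m) \<longleftrightarrow> embeds (verts (H1 m))"
proof -
  have "(0, 0) \<in> verts (H1 m)" by (simp add: in_verts_H1 st_def)
  then show ?thesis
    using contains_isometric_king_grid_iff[OF menger_convex_H1, of m]
    unfolding H1_def induce_subgraph_verts by blast
qed

lemma contains_H2_iff: "contains_isometric G (H2 m) \<longleftrightarrow> embeds (verts (H2 m))"
proof -
  have "(0, 0) \<in> verts (H2 m)" by (simp add: in_verts_H2 st_def)
  then show ?thesis
    using contains_isometric_king_grid_iff[OF menger_convex_H2, of m]
    unfolding H2_def induce_subgraph_verts by blast
qed

lemma contains_H3_iff: "contains_isometric G (H3 m) \<longleftrightarrow> embeds (verts (H3 m))"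
proof -
  have "(0, 0) \<in> verts (H3 m)" by (simp add: in_verts_H3 st_def)
  then show ?thesis
    using contains_isometric_king_grid_iff[OF menger_convex_H3, of m]
    unfolding H3_def induce_subgraph_verts by blast
qed

lemma embeds_imp_wide_quadruple:
  assumes "embeds S" and S: "{a, b, c, d} \<subseteq> S"
    and "cheb a b + cheb c d + N \<le> cheb a c + cheb b d"
    and "cheb a d + cheb b c + N \<le> cheb a c + cheb b d"
  shows "\<exists>a b c d. wide_quadruple N a b c d"
proof -
  obtain f where f: "f ` S \<subseteq> verts G" "\<And>u v. u \<in> S \<Longrightarrow> v \<in> S \<Longrightarrow> gdist G (f u) (f v) = cheb u v"
    using assms(1) unfolding embeds_def by blast
  have "f a \<in> verts G" "f b \<in> verts G" "f c \<in> verts G" "f d \<in> verts G"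
    using f(1) S by blast+
  then have "wide_quadruple N (f a) (f b) (f c) (f d)"
    using f(2) S assms(3,4) by (simp add: wide_quadruple_def)
  then show ?thesis by blast
qed

text \<open>At the corners of the square both diagonals have length \<open>2 * m\<close> and all
  sides have length \<open>m\<close>.\<close>

lemma embeds_H1_imp_wide_quadruple:
  "embeds (verts (H1 m)) \<Longrightarrow> \<exists>a b c d. wide_quadruple (2 * m) a b c d"
  by (rule embeds_imp_wide_quadruple[where S = "verts (H1 m)" and a = "(int m, - int m)" and b = "(0, 0)"
        and c = "(int m, int m)" and d = "(2 * int m, 0)"])
    (simp_all add: in_verts_H1 st_def cheb_def)

text \<open>The two extra vertices stand in for the box corners of the wrong parity. The largest sum
  is \<open>4 * m + 3\<close>, the others are \<open>2 * m + 2\<close>.\<close>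

lemma embeds_H2_imp_wide_quadruple:
  "embeds (verts (H2 m)) \<Longrightarrow> \<exists>a b c d. wide_quadruple (2 * m + 1) a b c d"
  by (rule embeds_imp_wide_quadruple[where S = "verts (H2 m)" and a = "(int m, - int m)" and b = "(- 1, 0)"
        and c = "(int m, int m + 1)" and d = "(2 * int m + 1, 1)"])
    (simp_all add: in_verts_H2 st_def cheb_def)

text \<open>At the four extra vertices the largest sum is \<open>4 * m + 6\<close>, the others are
  \<open>2 * m + 4\<close>.\<close>

lemma embeds_H3_imp_wide_quadruple:
  "embeds (verts (H3 m)) \<Longrightarrow> \<exists>a b c d. wide_quadruple (2 * m + 2) a b c d"
  by (rule embeds_imp_wide_quadruple[where S = "verts (H3 m)" and a = "(int m, - int m - 1)" and b = "(- 1, 1)"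
        and c = "(int m + 1, int m + 2)" and d = "(2 * int m + 2, 0)"])
    (simp_all add: in_verts_H3 st_def cheb_def)

text \<open>The square \<open>H1 (m + 1)\<close> consists of even points. It fits at the origin if
  \<beta> is even and after a shift by one if \<open>W\<close> or \<open>T\<close> exceeds
  \<open>N\<close>; in the remaining case the whiskers have room for \<open>H3 m\<close>.\<close>

lemma wide_quadruple_imp_embeds_H1_or_H3:
  assumes helly: "helly G" and wide: "wide_quadruple (2 * m + 2) a b c d"
  shows "embeds (verts (H1 (m + 1))) \<or> embeds (verts (H3 m))"
proof -
  define N where "N = 2 * int m + 2"
  have N: "N = int (2 * m + 2)" by (simp add: N_def)
  have N_pos: "0 < 2 * m + 2" by simp
  obtain W T \<alpha> \<beta> \<gamma> \<delta> :: int where WT: "N \<le> W" "N \<le> T"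
    and nonneg: "\<alpha> \<ge> 0" "\<beta> \<ge> 0" "\<gamma> \<ge> 0" "\<delta> \<ge> 0"
    and parity: "even (T + \<alpha> + \<beta>)" "even (W + \<gamma> + \<beta>)" "even (W + T + \<delta> + \<beta>)"
    and real: "realizes_pinwheel W T \<alpha> \<beta> \<gamma> \<delta>"
    by (rule wide_quadruple_pinwheelE[OF helly wide N_pos, folded N])
  have shift: "embeds (verts (H1 (m + 1)))"
    if "0 \<le> i" "0 \<le> j" "N + i \<le> W" "N + j \<le> T" "even (i + j + \<beta>)" for i j
  proof (rule realizes_pinwheelD[OF real, where \<phi> = "\<lambda>u. (fst (st u) + i, snd (st u) + j)"])
    show "finite (verts (H1 (m + 1)))" by (rule finite_verts_H1)
    show "l1 (fst (st u) + i, snd (st u) + j) (fst (st v) + i, snd (st v) + j) = 2 * int (cheb u v)" for u v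
      by (simp add: l1_st[symmetric] l1_def)
    show "even (fst (fst (st u) + i, snd (st u) + j) + snd (fst (st u) + i, snd (st u) + j) + \<beta>)" for u
      using that(5) unfolding st_def fst_conv snd_conv by presburger
    fix u v assume "u \<in> verts (H1 (m + 1))" "v \<in> verts (H1 (m + 1))"
    then show "pinwheel_linked W T \<alpha> \<beta> \<gamma> \<delta>
        (fst (st u) + i, snd (st u) + j) (fst (st v) + i, snd (st v) + j)"
      using that nonneg by (intro pinwheel_linked_box) (simp_all add: in_verts_H1 N_def)
  qed
  show ?thesis
  proof (cases "even \<beta>")
    case True
    then show ?thesis using shift[of 0 0] WT by simp
  next
    case False
    consider "W > N" | "T > N" | "W = N" "T = N" using WT by linarith
    then show ?thesis
    proof cases
      case 1
      then show ?thesis using shift[of 1 0] WT False by simp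
    next
      case 2
      then show ?thesis using shift[of 0 1] WT False by simp
    next
      case 3
      \<comment> \<open>As \<open>N\<close> is even and \<beta> odd, the parity relations make all
        four whiskers odd.\<close>
      have pos: "\<alpha> \<ge> 1" "\<beta> \<ge> 1" "\<gamma> \<ge> 1" "\<delta> \<ge> 1"
        using parity nonneg False unfolding 3 N_def by presburger+
      have H3: "in_box N (fst (st u), snd (st u) + 1) \<or>
          (fst (st u), snd (st u) + 1) \<in> {(- 1, N), (0, - 1), (N + 1, 0), (N, N + 1)}"
        if "u \<in> verts (H3 m)" for u
        using that unfolding in_verts_H3 by (elim disjE insertE emptyE) (simp_all add: st_def N_def in_box_def)
      have "embeds (verts (H3 m))"
      \<comment> \<open>The added 1 makes the t-range of the box start at 0 and moves the piece to
        the odd points, as odd \<beta> demands.\<close>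
      proof (rule realizes_pinwheelD[OF real, where \<phi> = "\<lambda>u. (fst (st u), snd (st u) + 1)"])
        show "finite (verts (H3 m))" by (rule finite_verts_H3)
        show "l1 (fst (st u), snd (st u) + 1) (fst (st v), snd (st v) + 1) = 2 * int (cheb u v)" for u v
          by (simp add: l1_st[symmetric] l1_def)
        show "even (fst (fst (st u), snd (st u) + 1) + snd (fst (st u), snd (st u) + 1) + \<beta>)" for u
          using False unfolding st_def fst_conv snd_conv by presburger
        fix u v assume "u \<in> verts (H3 m)" "v \<in> verts (H3 m)"
        then show "pinwheel_linked W T \<alpha> \<beta> \<gamma> \<delta> (fst (st u), snd (st u) + 1) (fst (st v), snd (st v) + 1)"
          using pos H3 unfolding 3 by (intro pinwheel_linked_H3) (simp_all add: N_def)
      qed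
      then show ?thesis ..
    qed
  qed
qed

text \<open>The square has odd side \<open>N\<close>, and each extra vertex needs one more unit of
  room. Parity guarantees that room in the rectangle or in a whisker, and \<open>turn\<close>
  selects where it is used.\<close>

lemma wide_quadruple_imp_embeds_H2:
  assumes helly: "helly G" and wide: "wide_quadruple (2 * m + 1) a b c d"
  shows "embeds (verts (H2 m))"
proof -
  define N where "N = 2 * int m + 1"
  have N: "N = int (2 * m + 1)" by (simp add: N_def)
  have N_pos: "0 < 2 * m + 1" by simp
  obtain W T \<alpha> \<beta> \<gamma> \<delta> :: int where WT: "N \<le> W" "N \<le> T"
    and nonneg: "\<alpha> \<ge> 0" "\<beta> \<ge> 0" "\<gamma> \<ge> 0" "\<delta> \<ge> 0"
    and parity: "even (T + \<alpha> + \<beta>)" "even (W + \<gamma> + \<beta>)" "even (W + T + \<delta> + \<beta>)"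
    and real: "realizes_pinwheel W T \<alpha> \<beta> \<gamma> \<delta>"
    by (rule wide_quadruple_pinwheelE[OF helly wide N_pos, folded N])
  define pos where "pos u = (fst (st u), snd (st u) + 1)" for u
  have H2: "in_box N (pos u) \<or> pos u \<in> {(- 1, 0), (N + 1, N)}" if "u \<in> verts (H2 m)" for u
    using that unfolding in_verts_H2 pos_def
    by (elim disjE insertE emptyE) (simp_all add: st_def N_def in_box_def)
  have iso: "l1 (pos u) (pos v) = 2 * int (cheb u v)" for u v
    by (simp add: l1_st[symmetric] l1_def pos_def)
  have odd_pos: "odd (fst (pos u) + snd (pos u))" for u
    unfolding pos_def st_def fst_conv snd_conv by presburger
  have N1: "1 \<le> N" "odd N" by (simp_all add: N_def)
  show ?thesis
  proof (cases "even \<beta>")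
    case True
    \<comment> \<open>For even \<beta>, \<open>W = N\<close> makes \<gamma> odd and
      \<open>T = N\<close> makes \<alpha> odd, so a whisker helps out wherever the rectangle is
      tight.\<close>
    define turn where "turn \<longleftrightarrow> N < T"
    have "N + 1 \<le> W + \<gamma>" using parity(2) True N1(2) WT(1) nonneg(3) by presburger
    moreover have "if turn then N + 1 \<le> T else 1 \<le> \<alpha>"
      using parity(1) True N1(2) WT(2) nonneg(1) unfolding turn_def by presburger
    ultimately have linked: "pinwheel_linked W T \<alpha> \<beta> \<gamma> \<delta>
        (place_H2_even N turn (pos u)) (place_H2_even N turn (pos v))"
      if "u \<in> verts (H2 m)" "v \<in> verts (H2 m)" for u v
      by (rule pinwheel_linked_place_H2_even[OF N1(1) WT nonneg _ _ H2[OF that(1)] H2[OF that(2)]])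
    show ?thesis
    proof (rule realizes_pinwheelD[OF real finite_verts_H2 _ linked])
      show "even (fst (place_H2_even N turn (pos u)) + snd (place_H2_even N turn (pos u)) + \<beta>)" for u
        using odd_pos[of u] N1(2) True by (auto simp: place_H2_even_def)
      show "l1 (place_H2_even N turn (pos u)) (place_H2_even N turn (pos v)) = 2 * int (cheb u v)"
        if "u \<in> verts (H2 m)" "v \<in> verts (H2 m)" for u v
        using place_H2_isometry(2)[OF N1(1) H2[OF that(1)] H2[OF that(2)]] iso by simp
    qed
  next
    case False
    \<comment> \<open>Without turning, \<open>W\<close> exceeds \<open>N\<close>. If
      \<open>W = N\<close>, then \<open>T + \<delta>\<close> is even and hence exceeds the odd
      number \<open>N\<close>.\<close>
    define turn where "turn \<longleftrightarrow> N < T \<or> W = N"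
    have "1 \<le> \<beta>" using False nonneg(2) by presburger
    moreover have "if turn then N + 1 \<le> T + \<delta> else N + 1 \<le> W"
      using parity(3) False N1(2) WT nonneg(4) unfolding turn_def by presburger
    ultimately have linked: "pinwheel_linked W T \<alpha> \<beta> \<gamma> \<delta>
        (place_H2_odd N turn (pos u)) (place_H2_odd N turn (pos v))"
      if "u \<in> verts (H2 m)" "v \<in> verts (H2 m)" for u v
      by (rule pinwheel_linked_place_H2_odd[OF N1(1) WT nonneg(1) _ nonneg(3,4) _ H2[OF that(1)] H2[OF that(2)]])
    show ?thesis
    proof (rule realizes_pinwheelD[OF real finite_verts_H2 _ linked])
      show "even (fst (place_H2_odd N turn (pos u)) + snd (place_H2_odd N turn (pos u)) + \<beta>)" for u
        using odd_pos[of u] N1(2) False by (auto simp: place_H2_odd_def)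
      show "l1 (place_H2_odd N turn (pos u)) (place_H2_odd N turn (pos v)) = 2 * int (cheb u v)"
        if "u \<in> verts (H2 m)" "v \<in> verts (H2 m)" for u v
        using place_H2_isometry(1)[OF N1(1) H2[OF that(1)] H2[OF that(2)]] iso by simp
    qed
  qed
qed

end

theorem theorem3:
  fixes G :: "('a, 'b) pre_digraph" and k :: nat
  assumes "graph G" and "connected G" and "helly G"
  shows "(hb G \<le> real k \<longleftrightarrow> \<not> contains_isometric G (H2 k)) \<and>
         (hb G \<le> real k + 1 / 2 \<longleftrightarrow>
            \<not> contains_isometric G (H1 (k + 1)) \<and> \<not> contains_isometric G (H3 k))"
proof -
  interpret connected_graph G
    using assms(1,2) by (simp add: connected_graph_def connected_graph_axioms_def)
  \<comment> \<open>The thresholds \<open>k\<close> and \<open>k + 1 / 2\<close> are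
    \<open>(N - 1) / 2\<close> for \<open>N = 2 * k + 1\<close> and
    \<open>N = 2 * k + 2\<close>.\<close>
  have "real k < hb G \<longleftrightarrow> (\<exists>a b c d. wide_quadruple (2 * k + 1) a b c d)"
    using less_hb_iff[of "2 * k + 1"] by simp
  also have "\<dots> \<longleftrightarrow> contains_isometric G (H2 k)"
    using wide_quadruple_imp_embeds_H2[OF assms(3)] embeds_H2_imp_wide_quadruple contains_H2_iff by blast
  finally have i: "real k < hb G \<longleftrightarrow> contains_isometric G (H2 k)" .
  have "real k + 1 / 2 < hb G \<longleftrightarrow> (\<exists>a b c d. wide_quadruple (2 * k + 2) a b c d)"
    using less_hb_iff[of "2 * k + 2"] by (simp add: field_simps)
  also have "\<dots> \<longleftrightarrow> contains_isometric G (H1 (k + 1)) \<or> contains_isometric G (H3 k)"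
    using wide_quadruple_imp_embeds_H1_or_H3[OF assms(3), of k] embeds_H1_imp_wide_quadruple[of "k + 1"]
      embeds_H3_imp_wide_quadruple[of k]
    unfolding contains_H1_iff contains_H3_iff by auto
  finally have ii: "real k + 1 / 2 < hb G \<longleftrightarrow>
    contains_isometric G (H1 (k + 1)) \<or> contains_isometric G (H3 k)" .
  show ?thesis using i ii by (auto simp: not_less[symmetric])
qed

end
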